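(* Let $X=C^\infty(\mathbb{R})$ be endowed with the topology defined below, and let $Y$ be a real linear topological space. Every bounded-differentiable germ at $0\in C^\infty(\mathbb{R})$ of maps from $X$ to $Y$ has a global bounded-differentiable representative, and every compact-differentiable germ at $0\in C^\infty(\mathbb{R})$ of maps from $X$ to $Y$ has a global compact-differentiable representative.
   Context: $C^\infty(\mathbb{R})$ is the space of infinitely differentiable real functions on $\mathbb{R}$, with the topology defined by the collection $\|x\|_k=\max_{j\le k}\max_{t\in[-k,k]}|x^{(j)}(t)|$, $k=0,1,2,\dots$ Germs: two maps into $Y$ defined on neighborhoods of $0\in X$ are equivalent if they coincide on some neighborhood of $0$; a germ at $0$ is an equivalence class, and its members are its representatives. A representative is global if it is defined on all of $X$. A germ is bounded- (resp. compact-) differentiable if it has a representative that is so at every point of its (open) domain; a global representative is bounded- (resp. compact-) differentiable if it is so at every point of $X$. A map $f$ is bounded-differentiable at $x$ if there is a continuous linear operator $A:X\to Y$ such that for every bounded subset $S\subset X$, for $h\in S$ and $t\in\mathbb{R}$, $f(x+th)-f(x)=tAh+r(th)$ with $r(th)/t\to0$ uniformly in $h\in S$ as $t\to0$. It is compact (Hadamard) differentiable at $x$ if there is a continuous linear operator $A:X\to Y$ such that $f(x+t_nh_n)-f(x)=t_nAh+o(t_n)$ whenever $t_n\to0$ in $\mathbb{R}$ and $h_n\to h$ in $X$. *)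

theory Defs
  imports "HOL-Analysis.Analysis"
begin

section \<open>Real linear topological spaces\<close>

text \<open>The Hausdorff property is not assumed.\<close>

class real_tvs = real_vector + topological_ab_group_add +
  assumes tendsto_scaleR_Pair:
    "LIM x (nhds c \<times>\<^sub>F nhds a). fst x *\<^sub>R snd x :> nhds (c *\<^sub>R a)"

lemma tendsto_scaleR_tvs:
  fixes a :: "'a::real_tvs"
  assumes "(f \<longlongrightarrow> c) F" "(g \<longlongrightarrow> a) F"
  shows "((\<lambda>x. f x *\<^sub>R g x) \<longlongrightarrow> c *\<^sub>R a) F"
  using filterlim_compose[OF tendsto_scaleR_Pair filterlim_Pair[OF assms]] by simp

definition tvs_bounded :: "'a::real_tvs set \<Rightarrow> bool" where
  "tvs_bounded S \<longleftrightarrow>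
    (\<forall>U. open U \<and> 0 \<in> U \<longrightarrow> (\<exists>c>0. \<forall>s>c. S \<subseteq> (*\<^sub>R) s ` U))"


section \<open>Bounded and compact differentiability\<close>

text \<open>Both notions only depend on the values of \<open>f\<close> near \<open>x\<close>.\<close>

definition bounded_differentiable_at :: "('a::real_tvs \<Rightarrow> 'b::real_tvs) \<Rightarrow> 'a \<Rightarrow> bool" where
  "bounded_differentiable_at f x \<longleftrightarrow>
    (\<exists>A. linear A \<and> continuous_on UNIV A \<and>
      (\<forall>S. tvs_bounded S \<longrightarrow>
        (\<forall>W. open W \<and> 0 \<in> W \<longrightarrow>
          (\<forall>\<^sub>F t in at 0. \<forall>h\<in>S. (1 / t) *\<^sub>R (f (x + t *\<^sub>R h) - f x - t *\<^sub>R A h) \<in> W))))"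

text \<open>Terms with \<open>t n = 0\<close> are harmless: there the remainder vanishes, and so does the
  quotient, by the convention \<open>1 / 0 = 0\<close>.\<close>

definition compact_differentiable_at :: "('a::real_tvs \<Rightarrow> 'b::real_tvs) \<Rightarrow> 'a \<Rightarrow> bool" where
  "compact_differentiable_at f x \<longleftrightarrow>
    (\<exists>A. linear A \<and> continuous_on UNIV A \<and>
      (\<forall>(t :: nat \<Rightarrow> real) (h :: nat \<Rightarrow> 'a) h0. t \<longlonglongrightarrow> 0 \<and> h \<longlonglongrightarrow> h0 \<longrightarrow>
        (\<lambda>n. (1 / t n) *\<^sub>R (f (x + t n *\<^sub>R h n) - f x - t n *\<^sub>R A h0)) \<longlonglongrightarrow> 0))"


section \<open>Germs at the origin\<close>

definition local_map :: "('a::real_tvs \<rightharpoonup> 'b) \<Rightarrow> bool" where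
  "local_map f \<longleftrightarrow> 0 \<in> interior (dom f)"

definition germ_rel :: "(('a::real_tvs \<rightharpoonup> 'b) \<times> ('a \<rightharpoonup> 'b)) set" where
  "germ_rel = {(f, g). local_map f \<and> local_map g \<and> (\<forall>\<^sub>F x in nhds 0. f x = g x)}"

lemma equiv_germ_rel: "equiv (Collect local_map) germ_rel"
proof (rule equivI)
  show "germ_rel \<subseteq> Collect local_map \<times> Collect local_map"
    by (auto simp: germ_rel_def)
  show "refl_on (Collect local_map) germ_rel"
    by (auto simp: refl_on_def germ_rel_def)
  show "sym germ_rel"
    by (auto simp: sym_def germ_rel_def eq_commute)
  show "trans germ_rel"
    unfolding trans_def germ_rel_def by (auto elim: eventually_elim2)
qed

definition germs :: "('a::real_tvs \<rightharpoonup> 'b) set set" where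
  "germs = Collect local_map // germ_rel"

text \<open>At points \<open>x\<close> of an open domain, totalizing \<open>f\<close> by \<open>the \<circ> f\<close> does not affect
  differentiability at \<open>x\<close>.\<close>

definition bounded_differentiable_germ :: "('a::real_tvs \<rightharpoonup> 'b::real_tvs) set \<Rightarrow> bool" where
  "bounded_differentiable_germ \<gamma> \<longleftrightarrow>
    (\<exists>f\<in>\<gamma>. open (dom f) \<and> (\<forall>x\<in>dom f. bounded_differentiable_at (the \<circ> f) x))"

definition compact_differentiable_germ :: "('a::real_tvs \<rightharpoonup> 'b::real_tvs) set \<Rightarrow> bool" where
  "compact_differentiable_germ \<gamma> \<longleftrightarrow>
    (\<exists>f\<in>\<gamma>. open (dom f) \<and> (\<forall>x\<in>dom f. compact_differentiable_at (the \<circ> f) x))"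

definition global_representative :: "('a::real_tvs \<Rightarrow> 'b) \<Rightarrow> ('a \<rightharpoonup> 'b) set \<Rightarrow> bool" where
  "global_representative f \<gamma> \<longleftrightarrow> (Some \<circ> f) \<in> \<gamma>"


section \<open>The space of smooth real functions\<close>

definition smooth :: "(real \<Rightarrow> real) \<Rightarrow> bool" where
  "smooth x \<longleftrightarrow> (\<forall>j t. (deriv ^^ j) x differentiable at t)"

lemma smooth_DERIV:
  assumes "smooth x"
  shows "((deriv ^^ j) x has_real_derivative (deriv ^^ Suc j) x t) (at t)"
  using assms by (simp add: smooth_def DERIV_deriv_iff_real_differentiable)

lemma smoothI:
  assumes "D 0 = x" and "\<And>j t. (D j has_real_derivative D (Suc j) t) (at t)"
  shows "smooth x" and "(deriv ^^ j) x = D j"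
proof -
  show *: "(deriv ^^ j) x = D j" for j
  proof (induction j)
    case (Suc j)
    have "deriv (D j) = D (Suc j)"
      by (rule ext, rule DERIV_imp_deriv, rule assms(2))
    with Suc show ?case by simp
  qed (use assms in simp)
  show "smooth x"
    unfolding smooth_def * using assms(2) real_differentiable_def by blast
qed

lemma
  assumes "smooth x" "smooth y"
  shows smooth_lincomb: "smooth (\<lambda>t. a * x t + b * y t)"
    and deriv_lincomb:
      "(deriv ^^ j) (\<lambda>t. a * x t + b * y t) = (\<lambda>t. a * (deriv ^^ j) x t + b * (deriv ^^ j) y t)"
proof -
  let ?D = "\<lambda>j t. a * (deriv ^^ j) x t + b * (deriv ^^ j) y t"
  have 0: "?D 0 = (\<lambda>t. a * x t + b * y t)"
    by simp
  have 1: "(?D j has_real_derivative ?D (Suc j) t) (at t)" for j t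
    by (intro DERIV_add DERIV_cmult smooth_DERIV assms)
  from smoothI[of ?D, OF 0 1]
  show "smooth (\<lambda>t. a * x t + b * y t)"
    and "(deriv ^^ j) (\<lambda>t. a * x t + b * y t) = (\<lambda>t. a * (deriv ^^ j) x t + b * (deriv ^^ j) y t)"
    by blast+
qed

lemma smooth_zero: "smooth (\<lambda>t. 0)"
  by (rule smoothI[of "\<lambda>_ _. 0"]) auto

typedef cinf = "{x. smooth x}"
  morphisms cinf_apply Abs_cinf
  using smooth_zero by blast

setup_lifting type_definition_cinf

instantiation cinf :: real_vector
begin

lift_definition zero_cinf :: cinf is "\<lambda>t. 0" by (rule smooth_zero)

lift_definition plus_cinf :: "cinf \<Rightarrow> cinf \<Rightarrow> cinf" is "\<lambda>x y t. x t + y t"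
  using smooth_lincomb[of _ _ 1 1] by simp

lift_definition minus_cinf :: "cinf \<Rightarrow> cinf \<Rightarrow> cinf" is "\<lambda>x y t. x t - y t"
  using smooth_lincomb[of _ _ 1 "-1"] by simp

lift_definition uminus_cinf :: "cinf \<Rightarrow> cinf" is "\<lambda>x t. - x t"
  using smooth_lincomb[of _ _ "-1" 0] by simp

lift_definition scaleR_cinf :: "real \<Rightarrow> cinf \<Rightarrow> cinf" is "\<lambda>c x t. c * x t"
  using smooth_lincomb[of _ _ _ 0] by simp

instance
  by (standard; transfer; simp add: fun_eq_iff algebra_simps)

end

definition cinf_deriv :: "nat \<Rightarrow> cinf \<Rightarrow> real \<Rightarrow> real" where
  "cinf_deriv j x = (deriv ^^ j) (cinf_apply x)"

lemma cinf_DERIV: "(cinf_deriv j x has_real_derivative cinf_deriv (Suc j) x t) (at t)"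
  using smooth_DERIV[of "cinf_apply x"] cinf_apply[of x] by (simp add: cinf_deriv_def)

lemma continuous_on_cinf_deriv: "continuous_on T (cinf_deriv j x)"
  by (meson DERIV_isCont cinf_DERIV continuous_at_imp_continuous_on)

lemma cinf_deriv_add: "cinf_deriv j (x + y) t = cinf_deriv j x t + cinf_deriv j y t"
  using deriv_lincomb[of "cinf_apply x" "cinf_apply y" j 1 1] cinf_apply[of x] cinf_apply[of y]
  by (simp add: cinf_deriv_def plus_cinf.rep_eq fun_eq_iff)

lemma cinf_deriv_scaleR: "cinf_deriv j (c *\<^sub>R x) t = c * cinf_deriv j x t"
  using deriv_lincomb[of "cinf_apply x" "cinf_apply x" j c 0] cinf_apply[of x]
  by (simp add: cinf_deriv_def scaleR_cinf.rep_eq fun_eq_iff)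

text \<open>The supremum is a maximum: the interval is compact and the derivatives are continuous.\<close>

definition cinf_norm :: "nat \<Rightarrow> cinf \<Rightarrow> real" where
  "cinf_norm k x = (MAX j\<in>{..k}. SUP t\<in>{- real k..real k}. \<bar>cinf_deriv j x t\<bar>)"

lemma bdd_above_cinf_deriv: "bdd_above ((\<lambda>t. \<bar>cinf_deriv j x t\<bar>) ` {a..b})"
  by (intro bounded_imp_bdd_above compact_imp_bounded compact_continuous_image
      continuous_on_rabs continuous_on_cinf_deriv compact_Icc)

lemma cinf_norm_le_iff:
  "cinf_norm k x \<le> c \<longleftrightarrow> (\<forall>j\<le>k. \<forall>t\<in>{- real k..real k}. \<bar>cinf_deriv j x t\<bar> \<le> c)"
  unfolding cinf_norm_def
  by (subst Max_le_iff) (auto simp: cSUP_le_iff[OF _ bdd_above_cinf_deriv])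

lemma cinf_norm_upper:
  "j \<le> k \<Longrightarrow> t \<in> {- real k..real k} \<Longrightarrow> \<bar>cinf_deriv j x t\<bar> \<le> cinf_norm k x"
  using cinf_norm_le_iff[of k x "cinf_norm k x"] by blast

lemma cinf_norm_attained:
  obtains j t where "j \<le> k" "t \<in> {- real k..real k}" "cinf_norm k x = \<bar>cinf_deriv j x t\<bar>"
proof -
  have "cinf_norm k x \<in> (\<lambda>j. SUP t\<in>{- real k..real k}. \<bar>cinf_deriv j x t\<bar>) ` {..k}"
    unfolding cinf_norm_def by (rule Max_in) auto
  then obtain j where j: "j \<le> k" "cinf_norm k x = (SUP t\<in>{- real k..real k}. \<bar>cinf_deriv j x t\<bar>)"
    by auto
  obtain t where t: "t \<in> {- real k..real k}"
    "\<forall>s\<in>{- real k..real k}. \<bar>cinf_deriv j x s\<bar> \<le> \<bar>cinf_deriv j x t\<bar>"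
    using continuous_attains_sup[OF compact_Icc _ continuous_on_rabs[OF continuous_on_cinf_deriv],
        of "- real k" "real k" j x]
    by auto
  have "cinf_norm k x = \<bar>cinf_deriv j x t\<bar>"
    unfolding j(2) by (rule cSup_eq_maximum) (use t in auto)
  with j t that show ?thesis by blast
qed

lemma cinf_norm_nonneg: "0 \<le> cinf_norm k x"
  using cinf_norm_upper[of 0 k 0 x] by (auto intro: order_trans[OF abs_ge_zero])

lemma cinf_norm_triangle: "cinf_norm k (x + y) \<le> cinf_norm k x + cinf_norm k y"
  unfolding cinf_norm_le_iff cinf_deriv_add
  by (blast intro: order_trans[OF abs_triangle_ineq] add_mono cinf_norm_upper)

lemma cinf_norm_scaleR_le: "cinf_norm k (c *\<^sub>R x) \<le> \<bar>c\<bar> * cinf_norm k x"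
  unfolding cinf_norm_le_iff cinf_deriv_scaleR abs_mult
  by (blast intro: mult_left_mono cinf_norm_upper abs_ge_zero)

lemma cinf_norm_zero: "cinf_norm k 0 = 0"
  using cinf_norm_scaleR_le[of k 0 0] cinf_norm_nonneg[of k 0] by simp

lemma cinf_norm_minus: "cinf_norm k (x - y) = cinf_norm k (y - x)"
  using cinf_norm_scaleR_le[of k "-1" "x - y"] cinf_norm_scaleR_le[of k "-1" "y - x"] by simp

lemma cinf_norm_mono:
  assumes "k \<le> l" shows "cinf_norm k x \<le> cinf_norm l x"
  unfolding cinf_norm_le_iff using assms by (auto intro!: cinf_norm_upper)

text \<open>The seminorms increase with \<open>k\<close>, so the balls of the single seminorms are a base, and
  not merely a subbase, of the topology they define.\<close>

instantiation cinf :: topological_space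
begin

definition open_cinf :: "cinf set \<Rightarrow> bool" where
  "open_cinf U \<longleftrightarrow> (\<forall>x\<in>U. \<exists>k. \<exists>e>0. \<forall>y. cinf_norm k (y - x) < e \<longrightarrow> y \<in> U)"

instance
proof
  show "open (UNIV :: cinf set)"
    unfolding open_cinf_def by (auto intro: exI[of _ 1])
next
  fix S T :: "cinf set"
  assume S: "open S" and T: "open T"
  show "open (S \<inter> T)"
    unfolding open_cinf_def
  proof
    fix x assume x: "x \<in> S \<inter> T"
    obtain k d where k: "d > 0" "\<And>y. cinf_norm k (y - x) < d \<Longrightarrow> y \<in> S"
      using S x unfolding open_cinf_def by blast
    obtain l e where l: "e > 0" "\<And>y. cinf_norm l (y - x) < e \<Longrightarrow> y \<in> T"
      using T x unfolding open_cinf_def by blast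
    have "y \<in> S \<inter> T" if "cinf_norm (max k l) (y - x) < min d e" for y
      using that k(2)[of y] l(2)[of y] cinf_norm_mono[of k "max k l" "y - x"]
        cinf_norm_mono[of l "max k l" "y - x"] by auto
    with k(1) l(1) show "\<exists>k. \<exists>e>0. \<forall>y. cinf_norm k (y - x) < e \<longrightarrow> y \<in> S \<inter> T"
      by (intro exI[of _ "max k l"] exI[of _ "min d e"]) auto
  qed
next
  fix K :: "cinf set set"
  assume "\<forall>S\<in>K. open S"
  then show "open (\<Union>K)"
    unfolding open_cinf_def by (meson Union_iff)
qed

end

lemma open_cinf_ball: "open {y. cinf_norm k (y - x) < e}"
  unfolding open_cinf_def
proof
  fix y assume "y \<in> {y. cinf_norm k (y - x) < e}"
  then have "cinf_norm k (y - x) < e" by simp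
  moreover have "cinf_norm k (z - x) \<le> cinf_norm k (z - y) + cinf_norm k (y - x)" for z
    using cinf_norm_triangle[of k "z - y" "y - x"] by simp
  ultimately show "\<exists>l. \<exists>d>0. \<forall>z. cinf_norm l (z - y) < d \<longrightarrow> z \<in> {y. cinf_norm k (y - x) < e}"
    by (intro exI[of _ k] exI[of _ "e - cinf_norm k (y - x)"])
      (auto simp: less_diff_eq intro: le_less_trans)
qed

lemma eventually_nhds_cinf:
  fixes x :: cinf
  shows "eventually P (nhds x) \<longleftrightarrow> (\<exists>k. \<exists>e>0. \<forall>y. cinf_norm k (y - x) < e \<longrightarrow> P y)"
proof
  assume "eventually P (nhds x)"
  then show "\<exists>k. \<exists>e>0. \<forall>y. cinf_norm k (y - x) < e \<longrightarrow> P y"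
    unfolding eventually_nhds open_cinf_def by meson
next
  assume "\<exists>k. \<exists>e>0. \<forall>y. cinf_norm k (y - x) < e \<longrightarrow> P y"
  then obtain k e where "e > 0" "\<And>y. cinf_norm k (y - x) < e \<Longrightarrow> P y"
    by blast
  then show "eventually P (nhds x)"
    unfolding eventually_nhds
    by (intro exI[of _ "{y. cinf_norm k (y - x) < e}"]) (simp add: open_cinf_ball cinf_norm_zero)
qed

lemma tendsto_cinf_iff:
  "(f \<longlongrightarrow> (l :: cinf)) F \<longleftrightarrow> (\<forall>k. ((\<lambda>x. cinf_norm k (f x - l)) \<longlongrightarrow> 0) F)"
proof
  assume f: "(f \<longlongrightarrow> l) F"
  show "\<forall>k. ((\<lambda>x. cinf_norm k (f x - l)) \<longlongrightarrow> 0) F"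
  proof (intro allI tendstoI)
    fix k and e :: real
    assume "e > 0"
    then have "\<forall>\<^sub>F y in nhds l. cinf_norm k (y - l) < e"
      unfolding eventually_nhds_cinf by blast
    with f have "\<forall>\<^sub>F x in F. cinf_norm k (f x - l) < e"
      by (rule eventually_compose_filterlim[rotated])
    then show "\<forall>\<^sub>F x in F. dist (cinf_norm k (f x - l)) 0 < e"
      by (simp add: cinf_norm_nonneg)
  qed
next
  assume f: "\<forall>k. ((\<lambda>x. cinf_norm k (f x - l)) \<longlongrightarrow> 0) F"
  show "(f \<longlongrightarrow> l) F"
    unfolding filterlim_iff eventually_nhds_cinf
  proof (intro allI impI, elim exE conjE)
    fix P k and e :: real
    assume e: "e > 0" "\<forall>y. cinf_norm k (y - l) < e \<longrightarrow> P y"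
    from f e(1) have "\<forall>\<^sub>F x in F. cinf_norm k (f x - l) < e"
      by (auto dest: order_tendstoD(2))
    then show "\<forall>\<^sub>F x in F. P (f x)"
      by eventually_elim (use e in blast)
  qed
qed

instance cinf :: real_tvs
proof
  fix a b :: cinf
  have a: "((\<lambda>p. cinf_norm k (fst p - a)) \<longlongrightarrow> 0) (nhds a \<times>\<^sub>F nhds b)" for k
    using filterlim_fst[of "nhds a" "nhds b"] by (simp add: tendsto_cinf_iff)
  have b: "((\<lambda>p. cinf_norm k (snd p - b)) \<longlongrightarrow> 0) (nhds a \<times>\<^sub>F nhds b)" for k
    using filterlim_snd[of "nhds b" "nhds a"] by (simp add: tendsto_cinf_iff)
  have "((\<lambda>p. cinf_norm k (fst p + snd p - (a + b))) \<longlongrightarrow> 0) (nhds a \<times>\<^sub>F nhds b)" for k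
  proof (rule tendsto_sandwich)
    show "\<forall>\<^sub>F p in nhds a \<times>\<^sub>F nhds b. 0 \<le> cinf_norm k (fst p + snd p - (a + b))"
      by (simp add: cinf_norm_nonneg)
    show "\<forall>\<^sub>F p in nhds a \<times>\<^sub>F nhds b. cinf_norm k (fst p + snd p - (a + b))
        \<le> cinf_norm k (fst p - a) + cinf_norm k (snd p - b)"
      using cinf_norm_triangle[of k "fst _ - a" "snd _ - b"]
      by (intro always_eventually allI) (simp add: algebra_simps)
    show "((\<lambda>p. cinf_norm k (fst p - a) + cinf_norm k (snd p - b)) \<longlongrightarrow> 0) (nhds a \<times>\<^sub>F nhds b)"
      using tendsto_add[OF a b] by simp
  qed simp
  then show "LIM x (nhds a \<times>\<^sub>F nhds b). fst x + snd x :> nhds (a + b)"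
    by (simp add: tendsto_cinf_iff)
next
  fix a :: cinf
  have "((\<lambda>x. x) \<longlongrightarrow> a) (nhds a)"
    by (rule filterlim_ident)
  then show "(uminus \<longlongrightarrow> - a) (nhds a)"
    unfolding tendsto_cinf_iff using cinf_norm_minus[of _ a] by simp
next
  fix c :: real and a :: cinf
  let ?F = "nhds c \<times>\<^sub>F nhds a"
  have c: "(fst \<longlongrightarrow> c) ?F"
    by (rule filterlim_fst)
  have a: "((\<lambda>p. cinf_norm k (snd p - a)) \<longlongrightarrow> 0) ?F" for k
    using filterlim_snd[of "nhds a" "nhds c"] by (simp add: tendsto_cinf_iff)
  have "((\<lambda>p. cinf_norm k (fst p *\<^sub>R snd p - c *\<^sub>R a)) \<longlongrightarrow> 0) ?F" for k
  proof (rule tendsto_sandwich)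
    show "\<forall>\<^sub>F p in ?F. 0 \<le> cinf_norm k (fst p *\<^sub>R snd p - c *\<^sub>R a)"
      by (simp add: cinf_norm_nonneg)
    have "cinf_norm k (fst p *\<^sub>R snd p - c *\<^sub>R a)
        \<le> \<bar>fst p\<bar> * cinf_norm k (snd p - a) + \<bar>fst p - c\<bar> * cinf_norm k a" for p
    proof -
      have "fst p *\<^sub>R snd p - c *\<^sub>R a = fst p *\<^sub>R (snd p - a) + (fst p - c) *\<^sub>R a"
        by (simp add: algebra_simps)
      then show ?thesis
        by (simp only:) (rule order_trans[OF cinf_norm_triangle add_mono[OF cinf_norm_scaleR_le cinf_norm_scaleR_le]])
    qed
    then show "\<forall>\<^sub>F p in ?F. cinf_norm k (fst p *\<^sub>R snd p - c *\<^sub>R a)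
        \<le> \<bar>fst p\<bar> * cinf_norm k (snd p - a) + \<bar>fst p - c\<bar> * cinf_norm k a"
      by simp
    have "((\<lambda>p. \<bar>fst p\<bar> * cinf_norm k (snd p - a) + \<bar>fst p - c\<bar> * cinf_norm k a)
        \<longlongrightarrow> \<bar>c\<bar> * 0 + \<bar>c - c\<bar> * cinf_norm k a) ?F"
      by (intro tendsto_intros c a)
    then show "((\<lambda>p. \<bar>fst p\<bar> * cinf_norm k (snd p - a) + \<bar>fst p - c\<bar> * cinf_norm k a)
        \<longlongrightarrow> 0) ?F"
      by simp
  qed simp
  then show "LIM x ?F. fst x *\<^sub>R snd x :> nhds (c *\<^sub>R a)"
    by (simp add: tendsto_cinf_iff)
qed

end

theory Submission
  imports Defs
begin

text \<open>The topology of \<open>C\<^sup>\<infinity>(\<real>)\<close> is given by Hilbertian seminorms, and the square of such a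
  seminorm is a continuous quadratic form, hence differentiable. Composing it with a
  differentiable cutoff \<open>bump\<close> on the line gives bump functions: for every neighborhood \<open>U\<close> of
  \<open>0\<close> there is a differentiable \<open>g : C\<^sup>\<infinity>(\<real>) \<rightarrow> \<real>\<close> that is \<open>1\<close> near \<open>0\<close> and vanishes on an
  open set \<open>V\<close> with \<open>U \<union> V\<close> the whole space (\<open>cinf_bump_function\<close>). If \<open>f\<close> is a differentiable
  representative of the germ with open domain \<open>U\<close>, then \<open>F x = g x *\<^sub>R f x\<close> is global: it agrees
  with \<open>f\<close> near \<open>0\<close>, it is differentiable on \<open>U\<close> by the product rule, and it is zero, whatever
  value \<open>f\<close> is given outside \<open>U\<close>, on the open set \<open>V\<close>.

  The Hilbertian seminorms come from the forms \<open>sobolev_form k\<close>. The elementary inequality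
  \<open>f(t)\<^sup>2 \<le> f(s)\<^sup>2 + \<integral> (f\<^sup>2 + f'\<^sup>2)\<close>, which results from integrating \<open>(f\<^sup>2)' = 2 f f'\<close>, shows that
  the quadratic form of \<open>sobolev_form k\<close> dominates the square of \<open>cinf_norm k\<close>; in turn it is
  dominated by a multiple of the square of \<open>cinf_norm (k + 1)\<close>, which makes it continuous.

  Both notions of differentiability ask that the difference quotient remainder tend to zero
  along certain filters of increments \<open>(t, h)\<close>. The product rule, the chain rule and the locality
  of differentiability need only two properties of such a filter: \<open>t\<close> tends to zero, and \<open>h\<close>
  is bounded along it (\<open>increment_filter\<close>). The whole argument is therefore made once, for an
  arbitrary set of such filters, and covers both cases.\<close>

section \<open>Differentiability along filters of increments\<close>

text \<open>Scalar functions thereby fall under the same notions of differentiability as vector valued ones.\<close>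

instance real :: real_tvs
  by standard (intro tendsto_scaleR filterlim_fst filterlim_snd)

text \<open>The second condition says that \<open>h\<close> is bounded along the filter: by a standard criterion, a set
  is bounded iff null sequences of scalars times elements of it tend to zero.\<close>

definition increment_filter :: "(real \<times> 'a::real_tvs) filter \<Rightarrow> bool" where
  "increment_filter \<Phi> \<longleftrightarrow> (fst \<longlongrightarrow> 0) \<Phi> \<and>
    (\<forall>c. (c \<longlongrightarrow> 0) \<Phi> \<longrightarrow> ((\<lambda>p. c p *\<^sub>R snd p) \<longlongrightarrow> 0) \<Phi>)"

definition derivative_along ::
    "(real \<times> 'a::real_tvs) filter \<Rightarrow> ('a \<Rightarrow> 'b::real_tvs) \<Rightarrow> 'a \<Rightarrow> ('a \<Rightarrow> 'b) \<Rightarrow> bool" where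
  "derivative_along \<Phi> f x A \<longleftrightarrow>
    ((\<lambda>p. (1 / fst p) *\<^sub>R (f (x + fst p *\<^sub>R snd p) - f x - fst p *\<^sub>R A (snd p))) \<longlongrightarrow> 0) \<Phi>"

definition differentiable_along ::
    "(real \<times> 'a::real_tvs) filter set \<Rightarrow> ('a \<Rightarrow> 'b::real_tvs) \<Rightarrow> 'a \<Rightarrow> bool" where
  "differentiable_along \<K> f x \<longleftrightarrow>
    (\<exists>A. linear A \<and> continuous_on UNIV A \<and> (\<forall>\<Phi>\<in>\<K>. derivative_along \<Phi> f x A))"

definition bounded_increments :: "(real \<times> 'a::real_tvs) filter set" where
  "bounded_increments = (\<lambda>S. at 0 \<times>\<^sub>F principal S) ` Collect tvs_bounded"

definition convergent_increments :: "(real \<times> 'a::real_tvs) filter set" where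
  "convergent_increments = {filtermap (\<lambda>n. (t n, h n)) sequentially | t h h0.
     (t \<longlonglongrightarrow> 0) \<and> (h \<longlonglongrightarrow> h0)}"

section \<open>The two notions as instances\<close>

lemma tendsto_0_iff_open:
  "(u \<longlongrightarrow> (0::'a::real_tvs)) F \<longleftrightarrow> (\<forall>W. open W \<and> 0 \<in> W \<longrightarrow> (\<forall>\<^sub>F i in F. u i \<in> W))"
  by (auto simp: tendsto_def)

lemma tendsto_linear_0:
  assumes "linear A" "continuous_on UNIV A" "(u \<longlongrightarrow> 0) F"
  shows "((\<lambda>i. A (u i)) \<longlongrightarrow> (0::'b::real_tvs)) F"
  using continuous_on_tendsto_compose[OF assms(2,3)] linear_0[OF assms(1)] by simp

lemma eventually_prod_principal:
  "eventually P (F \<times>\<^sub>F principal S) \<longleftrightarrow> (\<forall>\<^sub>F t in F. \<forall>h\<in>S. P (t, h))"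
proof
  show "eventually P (F \<times>\<^sub>F principal S) \<Longrightarrow> \<forall>\<^sub>F t in F. \<forall>h\<in>S. P (t, h)"
    unfolding eventually_prod_filter eventually_principal by (auto elim: eventually_mono)
  show "\<forall>\<^sub>F t in F. \<forall>h\<in>S. P (t, h) \<Longrightarrow> eventually P (F \<times>\<^sub>F principal S)"
    unfolding eventually_prod_filter eventually_principal by blast
qed

lemma bounded_differentiable_at_iff:
  "bounded_differentiable_at f x \<longleftrightarrow> differentiable_along bounded_increments f x"
  unfolding bounded_differentiable_at_def differentiable_along_def bounded_increments_def
    derivative_along_def tendsto_0_iff_open
  by (simp add: eventually_prod_principal)

lemma tendsto_0_if:
  assumes "(u \<longlongrightarrow> (0::'a::real_tvs)) F"
  shows "((\<lambda>i. if P i then 0 else u i) \<longlongrightarrow> 0) F"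
  using assms unfolding tendsto_0_iff_open by (auto elim!: eventually_mono)

text \<open>Compact differentiability compares the increment of \<open>f\<close> with \<open>t\<^sub>n A h\<close>, not with \<open>t\<^sub>n A h\<^sub>n\<close>. The
  two quotients differ by \<open>A h\<^sub>n - A h\<close>, which tends to zero because \<open>A\<close> is continuous; where
  \<open>t\<^sub>n = 0\<close> both vanish.\<close>

lemma compact_differentiable_at_iff:
  fixes f :: "'a::real_tvs \<Rightarrow> 'b::real_tvs"
  shows "compact_differentiable_at f x \<longleftrightarrow> differentiable_along convergent_increments f x"
proof -
  have *: "((\<lambda>n. (1 / t n) *\<^sub>R (f (x + t n *\<^sub>R h n) - f x - t n *\<^sub>R A h0)) \<longlonglongrightarrow> 0) \<longleftrightarrow>
      derivative_along (filtermap (\<lambda>n. (t n, h n)) sequentially) f x A"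
    if A: "continuous_on UNIV A" and h: "h \<longlonglongrightarrow> h0"
    for A :: "'a \<Rightarrow> 'b" and t h h0
  proof -
    let ?v = "\<lambda>n. (1 / t n) *\<^sub>R (f (x + t n *\<^sub>R h n) - f x - t n *\<^sub>R A h0)"
    let ?u = "\<lambda>n. (1 / t n) *\<^sub>R (f (x + t n *\<^sub>R h n) - f x - t n *\<^sub>R A (h n))"
    let ?d = "\<lambda>n. if t n = 0 then 0 else A (h n) - A h0"
    have "(\<lambda>n. A (h n)) \<longlonglongrightarrow> A h0"
      using continuous_on_tendsto_compose[OF A h] by simp
    then have "(\<lambda>n. A (h n) - A h0) \<longlonglongrightarrow> A h0 - A h0"
      by (intro tendsto_diff tendsto_const)
    then have d: "?d \<longlonglongrightarrow> 0"
      by (intro tendsto_0_if) simp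
    have eq: "?v n = ?u n + ?d n" for n
      by (simp add: algebra_simps)
    have eq': "?u n = ?v n - ?d n" for n
      by (simp add: algebra_simps)
    have "?v \<longlonglongrightarrow> 0 \<longleftrightarrow> ?u \<longlonglongrightarrow> 0"
    proof
      assume "?u \<longlonglongrightarrow> 0"
      from tendsto_add[OF this d] show "?v \<longlonglongrightarrow> 0"
        by (simp only: eq add_0_left)
    next
      assume "?v \<longlonglongrightarrow> 0"
      from tendsto_diff[OF this d] show "?u \<longlonglongrightarrow> 0"
        by (simp only: eq' diff_0_right)
    qed
    then show ?thesis
      by (simp add: derivative_along_def filterlim_filtermap)
  qed
  have "(\<forall>t h h0. t \<longlonglongrightarrow> 0 \<and> h \<longlonglongrightarrow> h0 \<longrightarrow>
        (\<lambda>n. (1 / t n) *\<^sub>R (f (x + t n *\<^sub>R h n) - f x - t n *\<^sub>R A h0)) \<longlonglongrightarrow> 0) \<longleftrightarrow>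
      (\<forall>\<Phi>\<in>convergent_increments. derivative_along \<Phi> f x A)"
    if "continuous_on UNIV A" for A
    unfolding convergent_increments_def by (auto simp: *[OF that])
  then show ?thesis
    unfolding compact_differentiable_at_def differentiable_along_def by blast
qed

lemma increment_filter_bounded:
  assumes "\<Phi> \<in> bounded_increments"
  shows "increment_filter (\<Phi> :: (real \<times> 'a::real_tvs) filter)"
proof -
  obtain S :: "'a set" where S: "tvs_bounded S" and \<Phi>: "\<Phi> = at 0 \<times>\<^sub>F principal S"
    using assms by (auto simp: bounded_increments_def)
  have "(fst \<longlongrightarrow> (0::real)) \<Phi>"
    unfolding \<Phi> by (rule filterlim_mono[OF filterlim_fst at_within_le_nhds order_refl])
  moreover have "((\<lambda>p. c p *\<^sub>R snd p) \<longlongrightarrow> 0) \<Phi>" if c: "(c \<longlongrightarrow> 0) \<Phi>" for c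
    unfolding tendsto_0_iff_open
  proof safe
    fix W :: "'a set" assume W: "open W" "0 \<in> W"
    have cont: "continuous_on UNIV (uminus :: 'a \<Rightarrow> 'a)"
      by (intro continuous_intros)
    \<comment> \<open>A symmetric neighborhood, because the scalar may have either sign.\<close>
    have "open (W \<inter> uminus -` W)" "0 \<in> W \<inter> uminus -` W"
      using W open_vimage[OF W(1) cont] by auto
    then obtain M where M: "M > 0" "\<And>s. s > M \<Longrightarrow> S \<subseteq> (*\<^sub>R) s ` (W \<inter> uminus -` W)"
      using S unfolding tvs_bounded_def by blast
    have "\<forall>\<^sub>F p in \<Phi>. \<bar>c p\<bar> < 1 / M"
      using c M(1) by (auto simp: tendsto_iff)
    moreover have "\<forall>\<^sub>F p in \<Phi>. snd p \<in> S"
      unfolding \<Phi> by (auto simp: eventually_prod_principal)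
    ultimately show "\<forall>\<^sub>F p in \<Phi>. c p *\<^sub>R snd p \<in> W"
    proof eventually_elim
      case (elim p)
      show ?case
      proof (cases "c p = 0")
        case False
        then have "1 / \<bar>c p\<bar> > M"
          using elim(1) M(1) by (simp add: field_simps)
        then obtain w where w: "w \<in> W" "- w \<in> W" "snd p = (1 / \<bar>c p\<bar>) *\<^sub>R w"
          using M(2) elim(2) by fastforce
        then have "c p *\<^sub>R snd p = w \<or> c p *\<^sub>R snd p = - w"
          using False by (cases "c p > 0") auto
        with w show ?thesis by auto
      qed (use W in simp)
    qed
  qed
  ultimately show ?thesis
    unfolding increment_filter_def by blast
qed

lemma increment_filter_convergent:
  assumes "\<Phi> \<in> convergent_increments"
  shows "increment_filter (\<Phi> :: (real \<times> 'a::real_tvs) filter)"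
proof -
  obtain t h h0 where \<Phi>: "\<Phi> = filtermap (\<lambda>n. (t n, h n)) sequentially"
    and t: "t \<longlonglongrightarrow> 0" and h: "h \<longlonglongrightarrow> h0"
    using assms by (auto simp: convergent_increments_def)
  have "(\<lambda>n. c (t n, h n) *\<^sub>R h n) \<longlonglongrightarrow> 0" if "(\<lambda>n. c (t n, h n)) \<longlonglongrightarrow> 0" for c
    using tendsto_scaleR_tvs[OF that h] by simp
  with t show ?thesis
    by (simp add: increment_filter_def \<Phi> filterlim_filtermap)
qed

section \<open>Calculus along filters of increments\<close>

lemma increment_filter_linear:
  assumes "increment_filter \<Phi>" "linear A" "continuous_on UNIV A" "(c \<longlongrightarrow> 0) \<Phi>"
  shows "((\<lambda>p. c p *\<^sub>R A (snd p)) \<longlongrightarrow> (0::'b::real_tvs)) \<Phi>"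
proof -
  have "((\<lambda>p. A (c p *\<^sub>R snd p)) \<longlongrightarrow> 0) \<Phi>"
    using assms unfolding increment_filter_def by (auto intro: tendsto_linear_0[OF assms(2,3)])
  then show ?thesis
    by (simp add: linear_scale[OF assms(2)])
qed

lemma increment_filter_tendsto:
  assumes "increment_filter \<Phi>"
  shows "((\<lambda>p. x + fst p *\<^sub>R snd p) \<longlongrightarrow> x) \<Phi>"
  using assms tendsto_add[OF tendsto_const[of x \<Phi>], of "\<lambda>p. fst p *\<^sub>R snd p" 0]
  by (auto simp: increment_filter_def)

lemma derivative_along_continuous:
  assumes \<Phi>: "increment_filter \<Phi>" and A: "linear A" "continuous_on UNIV A"
    and f: "derivative_along \<Phi> f x A"
  shows "((\<lambda>p. f (x + fst p *\<^sub>R snd p) - f x) \<longlongrightarrow> 0) \<Phi>"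
proof -
  have t: "(fst \<longlongrightarrow> 0) \<Phi>"
    using \<Phi> by (simp add: increment_filter_def)
  let ?R = "\<lambda>p. (1 / fst p) *\<^sub>R (f (x + fst p *\<^sub>R snd p) - f x - fst p *\<^sub>R A (snd p))"
  have "((\<lambda>p. fst p *\<^sub>R ?R p + fst p *\<^sub>R A (snd p)) \<longlongrightarrow> 0 *\<^sub>R 0 + 0) \<Phi>"
    using f unfolding derivative_along_def
    by (intro tendsto_add tendsto_scaleR_tvs t increment_filter_linear \<Phi> A)
  moreover have "fst p *\<^sub>R ?R p + fst p *\<^sub>R A (snd p) = f (x + fst p *\<^sub>R snd p) - f x" for p
    by (cases "fst p = 0") auto
  ultimately show ?thesis
    by simp
qed

text \<open>With \<open>\<Delta>g\<close> the increment of \<open>g\<close> and \<open>Q\<close>, \<open>R\<close> the remainder quotients of \<open>g\<close> and \<open>f\<close>, the remainder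
  quotient of the product is \<open>(g x + \<Delta>g) R + \<Delta>g A h + Q f x\<close>. The middle term is where the
  boundedness of \<open>h\<close> enters: \<open>\<Delta>g\<close> tends to zero while \<open>A h\<close> is merely bounded.\<close>

lemma derivative_along_scaleR:
  fixes g :: "'a::real_tvs \<Rightarrow> real" and f :: "'a \<Rightarrow> 'b::real_tvs"
  assumes \<Phi>: "increment_filter \<Phi>"
    and D: "linear D" "continuous_on UNIV D" and g: "derivative_along \<Phi> g x D"
    and A: "linear A" "continuous_on UNIV A" and f: "derivative_along \<Phi> f x A"
  shows "derivative_along \<Phi> (\<lambda>y. g y *\<^sub>R f y) x (\<lambda>h. g x *\<^sub>R A h + D h *\<^sub>R f x)"
proof -
  let ?R = "\<lambda>p. (1 / fst p) *\<^sub>R (f (x + fst p *\<^sub>R snd p) - f x - fst p *\<^sub>R A (snd p))"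
  let ?Q = "\<lambda>p. (1 / fst p) *\<^sub>R (g (x + fst p *\<^sub>R snd p) - g x - fst p *\<^sub>R D (snd p))"
  let ?d = "\<lambda>p. g (x + fst p *\<^sub>R snd p) - g x"
  have d: "(?d \<longlongrightarrow> 0) \<Phi>"
    by (rule derivative_along_continuous[OF \<Phi> D g])
  have "((\<lambda>p. (?d p + g x) *\<^sub>R ?R p + ?d p *\<^sub>R A (snd p) + ?Q p *\<^sub>R f x)
      \<longlongrightarrow> (0 + g x) *\<^sub>R 0 + 0 + 0 *\<^sub>R f x) \<Phi>"
    using f g unfolding derivative_along_def
    by (intro tendsto_add tendsto_scaleR_tvs tendsto_const increment_filter_linear \<Phi> A d)
  moreover have "(?d p + g x) *\<^sub>R ?R p + ?d p *\<^sub>R A (snd p) + ?Q p *\<^sub>R f x =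
      (1 / fst p) *\<^sub>R (g (x + fst p *\<^sub>R snd p) *\<^sub>R f (x + fst p *\<^sub>R snd p) - g x *\<^sub>R f x
        - fst p *\<^sub>R (g x *\<^sub>R A (snd p) + D (snd p) *\<^sub>R f x))" for p
    by (cases "fst p = 0") (auto simp: algebra_simps diff_divide_distrib)
  ultimately show ?thesis
    by (simp add: derivative_along_def)
qed

lemma differentiable_along_scaleR:
  fixes g :: "'a::real_tvs \<Rightarrow> real" and f :: "'a \<Rightarrow> 'b::real_tvs"
  assumes \<K>: "\<And>\<Phi>. \<Phi> \<in> \<K> \<Longrightarrow> increment_filter \<Phi>"
    and g: "differentiable_along \<K> g x" and f: "differentiable_along \<K> f x"
  shows "differentiable_along \<K> (\<lambda>y. g y *\<^sub>R f y) x"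
proof -
  obtain D where D: "linear D" "continuous_on UNIV D" "\<And>\<Phi>. \<Phi> \<in> \<K> \<Longrightarrow> derivative_along \<Phi> g x D"
    using g by (auto simp: differentiable_along_def)
  obtain A where A: "linear A" "continuous_on UNIV A" "\<And>\<Phi>. \<Phi> \<in> \<K> \<Longrightarrow> derivative_along \<Phi> f x A"
    using f by (auto simp: differentiable_along_def)
  have "linear (\<lambda>h. g x *\<^sub>R A h + D h *\<^sub>R f x)"
    by (rule linearI) (simp_all add: linear_add[OF A(1)] linear_add[OF D(1)]
        linear_scale[OF A(1)] linear_scale[OF D(1)] algebra_simps)
  moreover have "continuous_on UNIV (\<lambda>h. g x *\<^sub>R A h + D h *\<^sub>R f x)"
    using A(2) D(2) unfolding continuous_on
    by (intro ballI tendsto_add tendsto_scaleR_tvs tendsto_const) auto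
  ultimately show ?thesis
    unfolding differentiable_along_def
    using derivative_along_scaleR[OF \<K> D(1,2) _ A(1,2)] A(3) D(3) by blast
qed

text \<open>Caratheodory's form of the derivative of \<open>\<phi>\<close>, \<open>\<phi> s - \<phi> (q x) = \<sigma> s (s - q x)\<close> with \<open>\<sigma>\<close>
  continuous at \<open>q x\<close>, writes the remainder quotient as \<open>\<sigma> Q + (\<sigma> - m) D h\<close>; no division by the
  increment of \<open>q\<close>, which may vanish, is needed.\<close>

lemma differentiable_along_compose_real:
  fixes q :: "'a::real_tvs \<Rightarrow> real"
  assumes \<K>: "\<And>\<Phi>. \<Phi> \<in> \<K> \<Longrightarrow> increment_filter \<Phi>"
    and q: "differentiable_along \<K> q x"
    and \<phi>: "(\<phi> has_real_derivative m) (at (q x))"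
  shows "differentiable_along \<K> (\<lambda>y. \<phi> (q y)) x"
proof -
  obtain D where D: "linear D" "continuous_on UNIV D" "\<And>\<Phi>. \<Phi> \<in> \<K> \<Longrightarrow> derivative_along \<Phi> q x D"
    using q by (auto simp: differentiable_along_def)
  obtain \<sigma> where \<sigma>: "\<And>s. \<phi> s - \<phi> (q x) = \<sigma> s * (s - q x)" "isCont \<sigma> (q x)" "\<sigma> (q x) = m"
    using \<phi> unfolding CARAT_DERIV by blast
  have "derivative_along \<Phi> (\<lambda>y. \<phi> (q y)) x (\<lambda>h. m * D h)" if "\<Phi> \<in> \<K>" for \<Phi>
  proof -
    have \<Phi>: "increment_filter \<Phi>" and q': "derivative_along \<Phi> q x D"
      using that \<K> D(3) by auto
    let ?Q = "\<lambda>p. (1 / fst p) *\<^sub>R (q (x + fst p *\<^sub>R snd p) - q x - fst p *\<^sub>R D (snd p))"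
    let ?c = "\<lambda>p. \<sigma> (q (x + fst p *\<^sub>R snd p)) - m"
    have "((\<lambda>p. (q (x + fst p *\<^sub>R snd p) - q x) + q x) \<longlongrightarrow> 0 + q x) \<Phi>"
      by (intro tendsto_add tendsto_const derivative_along_continuous[OF \<Phi> D(1,2) q'])
    then have "((\<lambda>p. \<sigma> (q (x + fst p *\<^sub>R snd p))) \<longlongrightarrow> m) \<Phi>"
      using isCont_tendsto_compose[OF \<sigma>(2)] \<sigma>(3) by simp
    then have c: "(?c \<longlongrightarrow> 0) \<Phi>"
      using tendsto_diff[OF _ tendsto_const[of m \<Phi>]] by fastforce
    have "((\<lambda>p. (?c p + m) * ?Q p + ?c p *\<^sub>R D (snd p)) \<longlongrightarrow> (0 + m) * 0 + 0) \<Phi>"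
      using q' unfolding derivative_along_def
      by (intro tendsto_add tendsto_mult tendsto_const increment_filter_linear \<Phi> D c)
    moreover have "(?c p + m) * ?Q p + ?c p *\<^sub>R D (snd p) = (1 / fst p) *\<^sub>R
        (\<phi> (q (x + fst p *\<^sub>R snd p)) - \<phi> (q x) - fst p *\<^sub>R (m * D (snd p)))" for p
      unfolding \<sigma>(1) by (cases "fst p = 0") (simp_all add: \<sigma>(3) field_simps)
    ultimately show ?thesis
      by (simp add: derivative_along_def)
  qed
  moreover have "linear (\<lambda>h. m * D h)"
    using linear_compose_scale_right[OF D(1), of m] by simp
  moreover have "continuous_on UNIV (\<lambda>h. m * D h)"
    by (intro continuous_intros D)
  ultimately show ?thesis
    unfolding differentiable_along_def by blast
qed

text \<open>Differentiability is local since \<open>x + t h\<close> eventually enters every neighborhood of \<open>x\<close>.\<close>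

lemma differentiable_along_cong:
  assumes \<K>: "\<And>\<Phi>. \<Phi> \<in> \<K> \<Longrightarrow> increment_filter \<Phi>"
    and f: "differentiable_along \<K> f x" and U: "open U" "x \<in> U" "\<And>y. y \<in> U \<Longrightarrow> f y = g y"
  shows "differentiable_along \<K> g x"
proof -
  have "derivative_along \<Phi> g x A" if "\<Phi> \<in> \<K>" "derivative_along \<Phi> f x A" for \<Phi> A
  proof -
    have "\<forall>\<^sub>F p in \<Phi>. x + fst p *\<^sub>R snd p \<in> U"
      using topological_tendstoD[OF increment_filter_tendsto[OF \<K>[OF that(1)]] U(1,2)] .
    then have "\<forall>\<^sub>F p in \<Phi>.
        (1 / fst p) *\<^sub>R (f (x + fst p *\<^sub>R snd p) - f x - fst p *\<^sub>R A (snd p)) =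
        (1 / fst p) *\<^sub>R (g (x + fst p *\<^sub>R snd p) - g x - fst p *\<^sub>R A (snd p))"
      by eventually_elim (simp add: U)
    then show ?thesis
      using that(2) unfolding derivative_along_def by (rule Lim_transform_eventually[rotated])
  qed
  then show ?thesis
    using f unfolding differentiable_along_def by blast
qed

lemma differentiable_along_zero: "differentiable_along \<K> (\<lambda>y. 0) x"
  unfolding differentiable_along_def derivative_along_def
  by (intro exI[of _ "\<lambda>h. 0"]) (auto simp: linear_zero)


section \<open>A differentiable cutoff on the line\<close>

text \<open>The square of the positive part is differentiable everywhere. Applied twice, it gives a
  cutoff equal to \<open>1\<close> up to \<open>1\<close> and to \<open>0\<close> from \<open>2\<close> on.\<close>

definition bump :: "real \<Rightarrow> real" where
  "bump s = (max 0 (1 - (max 0 (s - 1))\<^sup>2))\<^sup>2"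

lemma DERIV_max_0_square:
  "((\<lambda>u::real. (max 0 u)\<^sup>2) has_real_derivative 2 * max 0 u) (at u)"
proof (cases "u = 0")
  case True
  have "((\<lambda>h::real. (max 0 h)\<^sup>2 / h) \<longlongrightarrow> 0) (at 0)"
  proof (rule Lim_null_comparison)
    show "\<forall>\<^sub>F h::real in at 0. norm ((max 0 h)\<^sup>2 / h) \<le> \<bar>h\<bar>"
      by (auto simp: power2_eq_square max_def)
    show "((\<lambda>h::real. \<bar>h\<bar>) \<longlongrightarrow> 0) (at 0)"
      by (rule tendsto_rabs_zero) (rule tendsto_ident_at)
  qed
  with True show ?thesis
    by (simp add: DERIV_def)
next
  case False
  then consider "u > 0" | "u < 0" by linarith
  then show ?thesis
  proof cases
    case 1
    have "((\<lambda>u::real. u\<^sup>2) has_real_derivative 2 * max 0 u) (at u)"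
      using 1 by (auto intro!: derivative_eq_intros)
    then show ?thesis
      by (rule DERIV_cong_ev[THEN iffD1, rotated -1])
        (use 1 in \<open>auto intro!: eventually_mono[OF eventually_nhds_in_open[of "{0<..}"]]\<close>)
  next
    case 2
    have "((\<lambda>u::real. 0) has_real_derivative 2 * max 0 u) (at u)"
      using 2 by auto
    then show ?thesis
      by (rule DERIV_cong_ev[THEN iffD1, rotated -1])
        (use 2 in \<open>auto intro!: eventually_mono[OF eventually_nhds_in_open[of "{..<0}"]]\<close>)
  qed
qed

lemma DERIV_bump: "\<exists>m. (bump has_real_derivative m) (at s)"
  unfolding bump_def[abs_def]
  by (rule exI, rule DERIV_chain2[OF DERIV_max_0_square], rule DERIV_diff[OF DERIV_const],
      rule DERIV_chain2[OF DERIV_max_0_square], rule DERIV_diff[OF DERIV_ident DERIV_const])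

lemma bump_eq_1: "s \<le> 1 \<Longrightarrow> bump s = 1"
  by (simp add: bump_def)

lemma bump_eq_0:
  assumes "2 \<le> s" shows "bump s = 0"
proof -
  have "1 \<le> (s - 1)\<^sup>2"
    using assms by (intro one_le_power) simp
  with assms show ?thesis
    by (simp add: bump_def)
qed

section \<open>Hilbertian seminorms on the space of smooth functions\<close>

text \<open>Including the derivative of order \<open>k + 1\<close> under the integral is what lets the form control the
  maximum of the derivatives up to order \<open>k\<close>. The values at \<open>0\<close> are needed for \<open>k = 0\<close>, when the
  integral is over a single point; for \<open>k > 0\<close> they spare an averaging argument.\<close>

definition sobolev_form :: "nat \<Rightarrow> cinf \<Rightarrow> cinf \<Rightarrow> real" where
  "sobolev_form k x y = (\<Sum>j\<le>k. cinf_deriv j x 0 * cinf_deriv j y 0 +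
     integral {- real k..real k} (\<lambda>t. cinf_deriv j x t * cinf_deriv j y t +
       cinf_deriv (Suc j) x t * cinf_deriv (Suc j) y t))"

lemma integrable_sobolev:
  "(\<lambda>t. cinf_deriv j x t * cinf_deriv j y t +
       cinf_deriv (Suc j) x t * cinf_deriv (Suc j) y t) integrable_on {a..b}"
  by (intro integrable_continuous_real continuous_intros continuous_on_cinf_deriv)

lemma sobolev_form_commute: "sobolev_form k x y = sobolev_form k y x"
  by (simp add: sobolev_form_def mult.commute)

lemma sobolev_form_add: "sobolev_form k x (y + z) = sobolev_form k x y + sobolev_form k x z"
proof -
  have "integral {- real k..real k} (\<lambda>t. cinf_deriv j x t * cinf_deriv j (y + z) t +
       cinf_deriv (Suc j) x t * cinf_deriv (Suc j) (y + z) t) =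
     integral {- real k..real k} (\<lambda>t. cinf_deriv j x t * cinf_deriv j y t +
       cinf_deriv (Suc j) x t * cinf_deriv (Suc j) y t) +
     integral {- real k..real k} (\<lambda>t. cinf_deriv j x t * cinf_deriv j z t +
       cinf_deriv (Suc j) x t * cinf_deriv (Suc j) z t)" for j
    by (subst integral_add[OF integrable_sobolev integrable_sobolev, symmetric])
      (simp add: cinf_deriv_add algebra_simps)
  then show ?thesis
    by (simp add: sobolev_form_def cinf_deriv_add sum.distrib[symmetric] algebra_simps)
qed

lemma sobolev_form_scaleR: "sobolev_form k x (c *\<^sub>R y) = c * sobolev_form k x y"
proof -
  have "integral {- real k..real k} (\<lambda>t. cinf_deriv j x t * cinf_deriv j (c *\<^sub>R y) t +
       cinf_deriv (Suc j) x t * cinf_deriv (Suc j) (c *\<^sub>R y) t) =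
     c * integral {- real k..real k} (\<lambda>t. cinf_deriv j x t * cinf_deriv j y t +
       cinf_deriv (Suc j) x t * cinf_deriv (Suc j) y t)" for j
    by (subst integral_mult_right[symmetric]) (simp add: cinf_deriv_scaleR algebra_simps)
  then show ?thesis
    by (simp add: sobolev_form_def cinf_deriv_scaleR sum_distrib_left algebra_simps)
qed

lemma sobolev_form_add_left: "sobolev_form k (x + y) z = sobolev_form k x z + sobolev_form k y z"
  by (subst (1 2 3) sobolev_form_commute) (rule sobolev_form_add)

lemma sobolev_form_scaleR_left: "sobolev_form k (c *\<^sub>R x) y = c * sobolev_form k x y"
  by (subst (1 2) sobolev_form_commute) (rule sobolev_form_scaleR)

lemma linear_sobolev_form: "linear (sobolev_form k x)"
  by (rule linearI) (simp_all add: sobolev_form_add sobolev_form_scaleR)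

text \<open>A one-dimensional Sobolev inequality: \<open>f(t)\<^sup>2 - f(s)\<^sup>2\<close> is the integral of \<open>2 f f'\<close>, and
  \<open>|2 f f'| \<le> f\<^sup>2 + f'\<^sup>2\<close>.\<close>

lemma square_le_sobolev:
  fixes f f' :: "real \<Rightarrow> real"
  assumes f: "\<And>t. (f has_real_derivative f' t) (at t)" and f': "continuous_on {a..b} f'"
    and st: "s \<in> {a..b}" "t \<in> {a..b}"
  shows "(f t)\<^sup>2 \<le> (f s)\<^sup>2 + integral {a..b} (\<lambda>u. (f u)\<^sup>2 + (f' u)\<^sup>2)"
proof -
  let ?g = "\<lambda>u. (f u)\<^sup>2 + (f' u)\<^sup>2"
  have cf: "continuous_on T f" for T
    using f by (meson DERIV_isCont continuous_at_imp_continuous_on)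
  have *: "\<bar>(f d)\<^sup>2 - (f c)\<^sup>2\<bar> \<le> integral {a..b} ?g" if cd: "c \<in> {a..b}" "d \<in> {a..b}" "c \<le> d" for c d
  proof -
    have sub: "{c..d} \<subseteq> {a..b}" using cd by auto
    have g: "?g integrable_on {c..d}" "?g integrable_on {a..b}"
      by (intro integrable_continuous_real continuous_intros cf continuous_on_subset[OF f'] sub order_refl)+
    have I: "((\<lambda>u. 2 * f u * f' u) has_integral (f d)\<^sup>2 - (f c)\<^sup>2) {c..d}"
      by (rule fundamental_theorem_of_calculus[OF cd(3)])
        (auto simp: has_real_derivative_iff_has_vector_derivative[symmetric]
          intro!: derivative_eq_intros DERIV_subset[OF f])
    have "\<bar>(f d)\<^sup>2 - (f c)\<^sup>2\<bar> \<le> integral {c..d} ?g"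
      unfolding integral_unique[OF I, symmetric] real_norm_def[symmetric]
    proof (rule integral_norm_bound_integral[OF has_integral_integrable[OF I] g(1)])
      fix u show "norm (2 * f u * f' u) \<le> ?g u"
        using zero_le_power2[of "f u - f' u"] zero_le_power2[of "f u + f' u"]
        by (auto simp: power2_eq_square algebra_simps abs_le_iff)
    qed
    also have "\<dots> \<le> integral {a..b} ?g"
      by (rule integral_subset_le[OF sub g]) simp
    finally show ?thesis .
  qed
  show ?thesis
    using *[of s t] *[of t s] st by (cases "s \<le> t") auto
qed

text \<open>The seminorm is attained as the value of one derivative \<open>x\<^sup>(\<^sup>j\<^sup>)\<close> at one point; the Sobolev
  inequality between that point and \<open>0\<close> bounds its square by the summand of index \<open>j\<close>.\<close>

lemma cinf_norm_square_le: "(cinf_norm k x)\<^sup>2 \<le> sobolev_form k x x"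
proof -
  obtain j t where j: "j \<le> k" and t: "t \<in> {- real k..real k}"
    and eq: "cinf_norm k x = \<bar>cinf_deriv j x t\<bar>"
    by (rule cinf_norm_attained)
  let ?b = "\<lambda>i. cinf_deriv i x 0 * cinf_deriv i x 0 +
     integral {- real k..real k} (\<lambda>t. cinf_deriv i x t * cinf_deriv i x t +
       cinf_deriv (Suc i) x t * cinf_deriv (Suc i) x t)"
  have "(cinf_norm k x)\<^sup>2 \<le> ?b j"
    using square_le_sobolev[OF cinf_DERIV continuous_on_cinf_deriv _ t, of 0 j x]
    by (simp add: eq power2_eq_square)
  also have "\<dots> \<le> sobolev_form k x x"
    unfolding sobolev_form_def
    by (rule member_le_sum) (use j in \<open>auto intro!: add_nonneg_nonneg integral_nonneg integrable_sobolev\<close>)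
  finally show ?thesis .
qed

text \<open>There are \<open>k + 1\<close> summands; in each, three products of derivatives are at most the product
  of the seminorms, one at the point \<open>0\<close> and two under an integral over a length of \<open>2 k\<close>.\<close>

lemma sobolev_form_bound:
  "\<bar>sobolev_form k x y\<bar> \<le> real ((k + 1) * (4 * k + 1)) * (cinf_norm (Suc k) x * cinf_norm (Suc k) y)"
proof -
  let ?N = "cinf_norm (Suc k) x * cinf_norm (Suc k) y"
  have le: "\<bar>cinf_deriv j x t * cinf_deriv j y t\<bar> \<le> ?N"
    if "j \<le> Suc k" "t \<in> {- real k..real k}" for j t
    unfolding abs_mult using that
    by (intro mult_mono cinf_norm_upper cinf_norm_nonneg) auto
  have "\<bar>cinf_deriv j x 0 * cinf_deriv j y 0 +
     integral {- real k..real k} (\<lambda>t. cinf_deriv j x t * cinf_deriv j y t +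
       cinf_deriv (Suc j) x t * cinf_deriv (Suc j) y t)\<bar> \<le> (4 * k + 1) * ?N" if j: "j \<le> k" for j
  proof -
    have "\<bar>cinf_deriv j x 0 * cinf_deriv j y 0\<bar> \<le> ?N"
      using j by (intro le) auto
    moreover have "norm (integral {- real k..real k} (\<lambda>t. cinf_deriv j x t * cinf_deriv j y t +
        cinf_deriv (Suc j) x t * cinf_deriv (Suc j) y t)) \<le> 2 * ?N * (real k - (- real k))"
    proof (rule integral_bound)
      fix t assume t: "t \<in> {- real k..real k}"
      show "norm (cinf_deriv j x t * cinf_deriv j y t +
          cinf_deriv (Suc j) x t * cinf_deriv (Suc j) y t) \<le> 2 * ?N"
        using le[of j t] le[of "Suc j" t] j t by simp
    qed (auto intro!: continuous_intros continuous_on_cinf_deriv)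
    ultimately show ?thesis
      by (simp add: algebra_simps)
  qed
  then have "\<bar>sobolev_form k x y\<bar> \<le> of_nat (card {..k}) * ((4 * k + 1) * ?N)"
    unfolding sobolev_form_def
    by (intro order_trans[OF sum_abs] sum_bounded_above) auto
  then show ?thesis
    by (simp add: algebra_simps)
qed

lemma continuous_sobolev_form: "continuous_on UNIV (sobolev_form k x)"
  unfolding continuous_on
proof
  fix y :: cinf
  let ?C = "real ((k + 1) * (4 * k + 1)) * cinf_norm (Suc k) x"
  have "((\<lambda>z. cinf_norm (Suc k) (z - y)) \<longlongrightarrow> 0) (at y)"
    using tendsto_ident_at[of y UNIV] unfolding tendsto_cinf_iff by blast
  from tendsto_mult_right_zero[OF this, of ?C]
  have lim: "((\<lambda>z. ?C * cinf_norm (Suc k) (z - y)) \<longlongrightarrow> 0) (at y)" .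
  have "norm (sobolev_form k x z - sobolev_form k x y) \<le> ?C * cinf_norm (Suc k) (z - y)" for z
    using sobolev_form_bound[of k x "z - y"]
    by (simp only: linear_diff[OF linear_sobolev_form] real_norm_def mult.assoc)
  then have "((\<lambda>z. sobolev_form k x z - sobolev_form k x y) \<longlongrightarrow> 0) (at y)"
    by (intro Lim_null_comparison[OF _ lim] always_eventually allI)
  then show "(sobolev_form k x \<longlongrightarrow> sobolev_form k x y) (at y)"
    by (simp add: LIM_zero_iff)
qed

lemma sobolev_square_tendsto_0:
  assumes "(u \<longlongrightarrow> 0) F"
  shows "((\<lambda>i. sobolev_form k (u i) (u i)) \<longlongrightarrow> 0) F"
proof -
  let ?C = "real ((k + 1) * (4 * k + 1))"
  have "((\<lambda>i. cinf_norm (Suc k) (u i)) \<longlongrightarrow> 0) F"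
    using assms by (simp add: tendsto_cinf_iff)
  from tendsto_mult_right_zero[OF tendsto_mult_zero[OF this this], of ?C]
  have lim: "((\<lambda>i. ?C * (cinf_norm (Suc k) (u i) * cinf_norm (Suc k) (u i))) \<longlongrightarrow> 0) F" .
  have "norm (sobolev_form k (u i) (u i)) \<le> ?C * (cinf_norm (Suc k) (u i) * cinf_norm (Suc k) (u i))" for i
    unfolding real_norm_def by (rule sobolev_form_bound)
  then show ?thesis
    by (intro Lim_null_comparison[OF _ lim] always_eventually allI)
qed

lemma sobolev_square_add:
  "sobolev_form k (x + y) (x + y) = sobolev_form k x x + 2 * sobolev_form k x y + sobolev_form k y y"
  by (simp add: sobolev_form_add sobolev_form_add_left sobolev_form_commute[of k y x])

lemma continuous_sobolev_square: "continuous_on UNIV (\<lambda>x. sobolev_form k x x)"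
  unfolding continuous_on
proof
  fix x :: cinf
  have 1: "((\<lambda>z. z - x) \<longlongrightarrow> 0) (at x)"
    using tendsto_diff[OF tendsto_ident_at[of x UNIV] tendsto_const[of x]] by simp
  have "((\<lambda>z. sobolev_form k x x + 2 * sobolev_form k x (z - x) + sobolev_form k (z - x) (z - x))
      \<longlongrightarrow> sobolev_form k x x + 2 * 0 + 0) (at x)"
    by (intro tendsto_intros sobolev_square_tendsto_0 1
        tendsto_linear_0[OF linear_sobolev_form continuous_sobolev_form])
  then show "((\<lambda>x. sobolev_form k x x) \<longlongrightarrow> sobolev_form k x x) (at x)"
    by (simp add: sobolev_square_add[symmetric])
qed

text \<open>The remainder quotient of a quadratic form \<open>q\<close> is \<open>t q(h)\<close>. It tends to zero because its
  absolute value is \<open>q(\<surd>|t| h)\<close>, where \<open>\<surd>|t|\<close> tends to zero and \<open>h\<close> is bounded.\<close>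

lemma derivative_along_sobolev_square:
  assumes \<Phi>: "increment_filter \<Phi>"
  shows "derivative_along \<Phi> (\<lambda>x. sobolev_form k x x) x (\<lambda>h. 2 * sobolev_form k x h)"
proof -
  have t: "(fst \<longlongrightarrow> 0) \<Phi>"
    using \<Phi> by (simp add: increment_filter_def)
  then have "((\<lambda>p. sqrt \<bar>fst p\<bar>) \<longlongrightarrow> sqrt \<bar>0\<bar>) \<Phi>"
    by (intro tendsto_intros)
  then have "((\<lambda>p. sqrt \<bar>fst p\<bar> *\<^sub>R snd p) \<longlongrightarrow> 0) \<Phi>"
    using \<Phi> by (simp add: increment_filter_def)
  then have sqrt_lim: "((\<lambda>p. sobolev_form k (sqrt \<bar>fst p\<bar> *\<^sub>R snd p) (sqrt \<bar>fst p\<bar> *\<^sub>R snd p)) \<longlongrightarrow> 0) \<Phi>"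
    by (rule sobolev_square_tendsto_0)
  have square: "sobolev_form k (c *\<^sub>R h) (c *\<^sub>R h) = c * c * sobolev_form k h h" for c h
    by (simp add: sobolev_form_scaleR sobolev_form_scaleR_left)
  have lim: "((\<lambda>p. \<bar>fst p\<bar> * sobolev_form k (snd p) (snd p)) \<longlongrightarrow> 0) \<Phi>"
    using sqrt_lim unfolding square by simp
  have "0 \<le> sobolev_form k h h" for h
    by (rule order_trans[OF zero_le_power2 cinf_norm_square_le])
  then have "((\<lambda>p. fst p * sobolev_form k (snd p) (snd p)) \<longlongrightarrow> 0) \<Phi>"
    by (intro Lim_null_comparison[OF _ lim] always_eventually) (simp add: abs_mult)
  moreover have eq: "(1 / t) * (sobolev_form k (x + t *\<^sub>R h) (x + t *\<^sub>R h) - sobolev_form k x x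
      - t * (2 * sobolev_form k x h)) = t * sobolev_form k h h" for t h
    by (cases "t = 0")
      (simp_all add: sobolev_square_add sobolev_form_scaleR sobolev_form_scaleR_left)
  ultimately show ?thesis
    unfolding derivative_along_def real_scaleR_def eq by blast
qed

section \<open>Bump functions and extension of germs\<close>

lemma cinf_bump_function:
  assumes \<K>: "\<forall>\<Phi>\<in>\<K>. increment_filter \<Phi>" and U: "open U" "(0 :: cinf) \<in> U"
  obtains V and g :: "cinf \<Rightarrow> real" where "open V" "U \<union> V = UNIV" "\<forall>x\<in>V. g x = 0"
    "\<forall>\<^sub>F x in nhds 0. g x = 1"
    "\<forall>x. differentiable_along \<K> g x"
proof -
  obtain k e where e: "e > 0" and ball: "\<And>x. cinf_norm k x < e \<Longrightarrow> x \<in> U"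
    using U unfolding open_cinf_def by fastforce
  \<comment> \<open>With the factor \<open>4 / e\<^sup>2\<close>, \<open>q x \<le> 2\<close> forces the seminorm of \<open>x\<close> below \<open>e\<close>, so \<open>bump \<circ> q\<close> is
    supported inside \<open>U\<close>.\<close>
  define q where "q x = 4 / e\<^sup>2 * sobolev_form k x x" for x
  have cont: "continuous_on UNIV q"
    unfolding q_def by (intro continuous_intros continuous_sobolev_square)
  have "x \<in> U" if "q x \<le> 2" for x
  proof -
    have "(cinf_norm k x)\<^sup>2 \<le> e\<^sup>2 / 2"
      using cinf_norm_square_le[of k x] that e by (simp add: q_def field_simps)
    also have "\<dots> < e\<^sup>2" using e by simp
    finally show ?thesis
      using e by (intro ball) (simp add: power2_less_imp_less)
  qed
  then have cover: "U \<union> {x. q x > 2} = UNIV"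
    by force
  have "open {x. q x > 2}"
    using open_Collect_less[OF continuous_on_const cont] .
  moreover note cover
  moreover have "\<forall>x\<in>{x. q x > 2}. bump (q x) = 0"
    by (simp add: bump_eq_0)
  moreover have "\<forall>\<^sub>F x in nhds 0. bump (q x) = 1"
  proof -
    have "q 0 = 0"
      using linear_0[OF linear_sobolev_form] by (simp add: q_def)
    then have "\<forall>\<^sub>F x in nhds 0. x \<in> {x. q x < 1}"
      using open_Collect_less[OF cont continuous_on_const] by (intro eventually_nhds_in_open) auto
    then show ?thesis
      by eventually_elim (simp add: bump_eq_1)
  qed
  moreover have "\<forall>x. differentiable_along \<K> (\<lambda>x. bump (q x)) x"
  proof
    fix x
    have "linear (\<lambda>h. 2 * sobolev_form k x h)"
      using linear_compose_scale_right[OF linear_sobolev_form, of 2] by simp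
    moreover have "continuous_on UNIV (\<lambda>h. 2 * sobolev_form k x h)"
      by (intro continuous_intros continuous_sobolev_form)
    ultimately have "differentiable_along \<K> (\<lambda>x. sobolev_form k x x) x"
      using \<K> derivative_along_sobolev_square unfolding differentiable_along_def by blast
    moreover obtain m where "(bump has_real_derivative m) (at (q x))"
      using DERIV_bump by blast
    then have "((\<lambda>s. bump (4 / e\<^sup>2 * s)) has_real_derivative m * (4 / e\<^sup>2)) (at (sobolev_form k x x))"
      unfolding q_def by (rule DERIV_chain2[OF _ DERIV_cmult_Id])
    ultimately show "differentiable_along \<K> (\<lambda>x. bump (q x)) x"
      unfolding q_def using differentiable_along_compose_real \<K> by blast
  qed
  ultimately show thesis
    by (rule that)
qed

text \<open>Multiplication by the bump function extends the given representative by zero.\<close>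

lemma global_representative_along:
  fixes \<gamma> :: "(cinf \<rightharpoonup> 'b::real_tvs) set"
  assumes \<K>: "\<forall>\<Phi>\<in>\<K>. increment_filter \<Phi>"
    and \<gamma>: "\<gamma> \<in> germs" "f \<in> \<gamma>"
    and f: "open (dom f)" "\<And>x. x \<in> dom f \<Longrightarrow> differentiable_along \<K> (the \<circ> f) x"
  shows "\<exists>F. global_representative F \<gamma> \<and> (\<forall>x. differentiable_along \<K> F x)"
proof -
  have loc: "local_map f"
    using \<gamma> in_quotient_imp_subset[OF equiv_germ_rel] by (auto simp: germs_def)
  then have 0: "0 \<in> dom f"
    using interior_subset by (auto simp: local_map_def)
  obtain V and g :: "cinf \<Rightarrow> real" where g: "open V" "dom f \<union> V = UNIV" "\<forall>x\<in>V. g x = 0"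
    "\<forall>\<^sub>F x in nhds 0. g x = 1" "\<forall>x. differentiable_along \<K> g x"
    by (rule cinf_bump_function[OF \<K> f(1) 0])
  define F where "F x = g x *\<^sub>R (the \<circ> f) x" for x
  have "\<forall>\<^sub>F x in nhds 0. f x = (Some \<circ> F) x"
    using g(4) eventually_nhds_in_open[OF f(1) 0] by eventually_elim (auto simp: F_def)
  then have "(f, Some \<circ> F) \<in> germ_rel"
    using loc by (simp add: germ_rel_def) (simp add: local_map_def dom_def)
  then have "global_representative F \<gamma>"
    using in_quotient_imp_closed[OF equiv_germ_rel _ \<gamma>(2)] \<gamma>(1)
    by (simp add: germs_def global_representative_def)
  moreover have "differentiable_along \<K> F x" for x
  proof (cases "x \<in> V")
    case True
    then show ?thesis
      using \<K> by (intro differentiable_along_cong[OF _ differentiable_along_zero g(1)])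
        (auto simp: F_def g(3))
  next
    case False
    then have "x \<in> dom f"
      using g(2) by blast
    then show ?thesis
      unfolding F_def using \<K> by (intro differentiable_along_scaleR g(5)[rule_format] f(2)) auto
  qed
  ultimately show ?thesis
    by blast
qed

theorem corollary3p12:
  shows "(\<forall>\<gamma> \<in> (germs :: (cinf \<rightharpoonup> 'b::real_tvs) set set).
            bounded_differentiable_germ \<gamma> \<longrightarrow>
            (\<exists>F. global_representative F \<gamma> \<and> (\<forall>x. bounded_differentiable_at F x))) \<and>
         (\<forall>\<gamma> \<in> (germs :: (cinf \<rightharpoonup> 'b) set set).
            compact_differentiable_germ \<gamma> \<longrightarrow>
            (\<exists>F. global_representative F \<gamma> \<and> (\<forall>x. compact_differentiable_at F x)))"
proof (intro conjI ballI impI)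
  fix \<gamma> :: "(cinf \<rightharpoonup> 'b) set"
  assume "\<gamma> \<in> germs" "bounded_differentiable_germ \<gamma>"
  then show "\<exists>F. global_representative F \<gamma> \<and> (\<forall>x. bounded_differentiable_at F x)"
    using global_representative_along[of bounded_increments] increment_filter_bounded
    unfolding bounded_differentiable_germ_def bounded_differentiable_at_iff by metis
next
  fix \<gamma> :: "(cinf \<rightharpoonup> 'b) set"
  assume "\<gamma> \<in> germs" "compact_differentiable_germ \<gamma>"
  then show "\<exists>F. global_representative F \<gamma> \<and> (\<forall>x. compact_differentiable_at F x)"
    using global_representative_along[of convergent_increments] increment_filter_convergent
    unfolding compact_differentiable_germ_def compact_differentiable_at_iff by metis
qed

end
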